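(* Let $(d_1,d_2,d_3)$ be an $\varepsilon$-hyper relative differential operator on a Lie algebra $\mathfrak g$ with respect to a representation $(V;\rho)$, and for $k\in\mathbb Z_3$ let $T_k=d_k^{-1}$, $N_k=T_{k-1}\circ d_{k+1}$ and $S_k=d_{k+1}\circ T_{k-1}$. Then, for all $i,k\in\mathbb Z_3$ with $i\neq k$, $(T_i,S_k,N_k)$ is a KN-structure on $\mathfrak g$ with respect to $(V;\rho)$.
   Context: Everything is over a ground field $\mathbb K$. Let $\mathfrak g$ be a Lie algebra and $\rho:\mathfrak g\to\mathfrak{gl}(V)$ a representation, denoted $(V;\rho)$. A relative differential operator (with respect to $(V;\rho)$) is a linear map $d:\mathfrak g\to V$ with $d[x,y]=\rho(x)d(y)-\rho(y)d(x)$ for all $x,y\in\mathfrak g$. An $\mathcal O$-operator (with respect to $(V;\rho)$) is a linear map $T:V\to\mathfrak g$ with $[Tu,Tv]=T(\rho(Tu)v-\rho(Tv)u)$ for all $u,v\in V$. A Nijenhuis operator on $\mathfrak g$ is a linear map $N:\mathfrak g\to\mathfrak g$ with $[N(x),N(y)]=N\big([N(x),y]+[x,N(y)]-N[x,y]\big)$ for all $x,y\in\mathfrak g$. Indices are in $\mathbb Z_3=\{1,2,3\}$ (mod 3). Let $d_1,d_2,d_3:\mathfrak g\to V$ be invertible relative differential operators with respect to $(V;\rho)$; set $T_i:=d_i^{-1}$ and $N_i:=T_{i-1}\circ d_{i+1}$. If $N_i^2=\varepsilon_i\,\mathrm{Id}_{\mathfrak g}$ with $\varepsilon_i\in\{1,-1\}$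 for $i=1,2,3$, the triple $(d_1,d_2,d_3)$ is called an $\varepsilon=(\varepsilon_1,\varepsilon_2,\varepsilon_3)$-hyper relative differential operator. A dual-Nijenhuis pair on $\mathfrak g$ with representation $(V;\rho)$ is a pair $(N,S)$ with $N\in\mathfrak{gl}(\mathfrak g)$ a Nijenhuis operator and $S\in\mathfrak{gl}(V)$ satisfying $\rho(Nx)(Sv)=S(\rho(Nx)v)+\rho(x)(S^2v)-S(\rho(x)(Sv))$ for all $x\in\mathfrak g$, $v\in V$. For a linear map $R:V\to\mathfrak g$ put $[u,v]^R:=\rho(Ru)v-\rho(Rv)u$, and for $S\in\mathfrak{gl}(V)$ put $[u,v]^R_S:=[Su,v]^R+[u,Sv]^R-S[u,v]^R$. A KN-structure (Kupershmidt-dual-Nijenhuis structure) on $\mathfrak g$ with respect to $(V;\rho)$ is a triple $(T,S,N)$ with $T:V\to\mathfrak g$ an $\mathcal O$-operator and $(N,S)$ a dual-Nijenhuis pair such that $N\circ T=T\circ S$ and $[u,v]^{N\circ T}=[u,v]^T_S$ for all $u,v\in V$. *)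

theory Defs
  imports Complex_Main "HOL-Library.Numeral_Type"
begin

locale lie_algebra = vector_space scaleg
  for scaleg :: "'k::field \<Rightarrow> 'g::ab_group_add \<Rightarrow> 'g" +
  fixes lie :: "'g \<Rightarrow> 'g \<Rightarrow> 'g"
  assumes linear_lie_right: "Vector_Spaces.linear scaleg scaleg (\<lambda>y. lie x y)"
    and linear_lie_left: "Vector_Spaces.linear scaleg scaleg (\<lambda>x. lie x y)"
    and lie_self: "lie x x = 0"
    and jacobi: "lie x (lie y z) + lie y (lie z x) + lie z (lie x y) = 0"
begin

definition nijenhuis_operator :: "('g \<Rightarrow> 'g) \<Rightarrow> bool" where
  "nijenhuis_operator N \<longleftrightarrow>
     Vector_Spaces.linear scaleg scaleg N \<and>
     (\<forall>x y. lie (N x) (N y) = N (lie (N x) y + lie x (N y) - N (lie x y)))"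

end

locale lie_algebra_representation =
  lie_algebra scaleg lie + V: vector_space scalev
  for scaleg :: "'k::field \<Rightarrow> 'g::ab_group_add \<Rightarrow> 'g"
    and lie :: "'g \<Rightarrow> 'g \<Rightarrow> 'g"
    and scalev :: "'k \<Rightarrow> 'v::ab_group_add \<Rightarrow> 'v" +
  fixes \<rho> :: "'g \<Rightarrow> 'v \<Rightarrow> 'v"
  assumes linear_rep: "Vector_Spaces.linear scalev scalev (\<rho> x)"
    and linear_rep_left: "Vector_Spaces.linear scaleg scalev (\<lambda>x. \<rho> x v)"
    and rep_lie: "\<rho> (lie x y) v = \<rho> x (\<rho> y v) - \<rho> y (\<rho> x v)"
begin

definition relative_differential_operator :: "('g \<Rightarrow> 'v) \<Rightarrow> bool" where
  "relative_differential_operator d \<longleftrightarrow>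
     Vector_Spaces.linear scaleg scalev d \<and>
     (\<forall>x y. d (lie x y) = \<rho> x (d y) - \<rho> y (d x))"

definition O_operator :: "('v \<Rightarrow> 'g) \<Rightarrow> bool" where
  "O_operator T \<longleftrightarrow>
     Vector_Spaces.linear scalev scaleg T \<and>
     (\<forall>u v. lie (T u) (T v) = T (\<rho> (T u) v - \<rho> (T v) u))"

definition dual_nijenhuis_pair :: "('g \<Rightarrow> 'g) \<Rightarrow> ('v \<Rightarrow> 'v) \<Rightarrow> bool" where
  "dual_nijenhuis_pair N S \<longleftrightarrow>
     nijenhuis_operator N \<and>
     Vector_Spaces.linear scalev scalev S \<and>
     (\<forall>x v. \<rho> (N x) (S v) = S (\<rho> (N x) v) + \<rho> x (S (S v)) - S (\<rho> x (S v)))"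

text \<open>The bracket \<open>[u,v]\<^sup>R\<close> on \<open>V\<close> and its deformation \<open>[u,v]\<^sup>R\<^sub>S\<close> by \<open>S\<close>.\<close>

definition op_bracket :: "('v \<Rightarrow> 'g) \<Rightarrow> 'v \<Rightarrow> 'v \<Rightarrow> 'v" where
  "op_bracket R u v = \<rho> (R u) v - \<rho> (R v) u"

definition deformed_op_bracket :: "('v \<Rightarrow> 'g) \<Rightarrow> ('v \<Rightarrow> 'v) \<Rightarrow> 'v \<Rightarrow> 'v \<Rightarrow> 'v" where
  "deformed_op_bracket R S u v =
     op_bracket R (S u) v + op_bracket R u (S v) - S (op_bracket R u v)"

definition KN_structure :: "('v \<Rightarrow> 'g) \<Rightarrow> ('v \<Rightarrow> 'v) \<Rightarrow> ('g \<Rightarrow> 'g) \<Rightarrow> bool" where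
  "KN_structure T S N \<longleftrightarrow>
     O_operator T \<and> dual_nijenhuis_pair N S \<and>
     N \<circ> T = T \<circ> S \<and>
     (\<forall>u v. op_bracket (N \<circ> T) u v = deformed_op_bracket T S u v)"

end

text \<open>
  The index set \<open>\<int>\<^sub>3\<close> is the type \<open>3\<close>, whose arithmetic is modulo 3 (so the index 3 is 0);
  a triple is a function on it.  Below, \<open>inv (d k)\<close> is the inverse map only when \<open>d k\<close> is
  bijective, as required in \<open>hyper_relative_differential_operator\<close>.
\<close>

definition hyper_T :: "(3 \<Rightarrow> 'g \<Rightarrow> 'v) \<Rightarrow> 3 \<Rightarrow> 'v \<Rightarrow> 'g" where
  "hyper_T d k = inv (d k)"

definition hyper_N :: "(3 \<Rightarrow> 'g \<Rightarrow> 'v) \<Rightarrow> 3 \<Rightarrow> 'g \<Rightarrow> 'g" where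
  "hyper_N d k = hyper_T d (k - 1) \<circ> d (k + 1)"

definition hyper_S :: "(3 \<Rightarrow> 'g \<Rightarrow> 'v) \<Rightarrow> 3 \<Rightarrow> 'v \<Rightarrow> 'v" where
  "hyper_S d k = d (k + 1) \<circ> hyper_T d (k - 1)"

definition (in lie_algebra_representation) hyper_relative_differential_operator ::
    "(3 \<Rightarrow> 'k) \<Rightarrow> (3 \<Rightarrow> 'g \<Rightarrow> 'v) \<Rightarrow> bool" where
  "hyper_relative_differential_operator \<epsilon> d \<longleftrightarrow>
     (\<forall>i. relative_differential_operator (d i) \<and> bij (d i)) \<and>
     (\<forall>i. \<epsilon> i \<in> {1, - 1}) \<and>
     (\<forall>i x. hyper_N d i (hyper_N d i x) = scaleg (\<epsilon> i) x)"

end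

theory Submission
  imports Defs
begin

text \<open>
  Write \<open>a = d (k - 1)\<close>, \<open>b = d (k + 1)\<close>, \<open>N = N\<^sub>k\<close>, \<open>S = S\<^sub>k\<close>. By construction \<open>b = a \<circ> N\<close>,
  and \<open>N\<^sup>2 = \<epsilon>\<^sub>k Id\<close> turns this into \<open>b \<circ> N = \<epsilon>\<^sub>k a\<close>. Hence both choices \<open>e = a\<close> and \<open>e = b\<close>,
  which are exactly the \<open>d i\<close> with \<open>i \<noteq> k\<close>, are in the same situation: \<open>e\<close> is an invertible
  relative differential operator, \<open>e \<circ> N\<close> is again a relative differential operator, \<open>N\<^sup>2\<close> is a
  scalar, and \<open>S = e \<circ> N \<circ> e\<^sup>-\<^sup>1\<close>. The statement is thus a consequence of the lemma
  \<open>KN_structure_of_conjugate\<close> about one such \<open>e\<close>.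

  For that lemma everything is transported to \<open>\<gg>\<close> along \<open>e\<close>. The \<open>\<O>\<close>-operator identity for
  \<open>e\<^sup>-\<^sup>1\<close> is the derivation rule of \<open>e\<close>, and the bracket condition is the derivation rule of
  \<open>e \<circ> N\<close>. The Nijenhuis identity and the dual condition compare the derivation rules of \<open>e\<close> and
  \<open>e \<circ> N\<close> on brackets with \<open>N\<close> in one argument, where \<open>e \<circ> N \<circ> N\<close> is again a multiple of \<open>e\<close>.
\<close>

lemma linear_inv_of_bij:
  assumes "Vector_Spaces.linear s1 s2 f" and "bij f"
  shows "Vector_Spaces.linear s2 s1 (inv f)"
proof -
  have inj: "inj f" and f_inv: "\<And>y. f (inv f y) = y"
    using assms(2) by (auto simp: bij_def surj_f_inv_f)
  from assms(1) have add: "\<And>x y. f (x + y) = f x + f y"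
    and scale: "\<And>c x. f (s1 c x) = s2 c (f x)"
    by (auto simp: Vector_Spaces.linear_iff)
  have "inv f (x + y) = inv f x + inv f y" for x y
    by (rule injD[OF inj]) (simp add: f_inv add)
  moreover have "inv f (s2 c x) = s1 c (inv f x)" for c x
    by (rule injD[OF inj]) (simp add: f_inv scale)
  ultimately show ?thesis
    using assms(1) by (auto simp: Vector_Spaces.linear_iff)
qed

context lie_algebra_representation
begin

lemma rep_scale: "\<rho> x (scalev c v) = scalev c (\<rho> x v)"
  using linear_rep[of x] by (simp add: Vector_Spaces.linear_iff)

lemma relative_differential_operator_linear:
  "relative_differential_operator d \<Longrightarrow> Vector_Spaces.linear scaleg scalev d"
  by (simp add: relative_differential_operator_def)

lemma relative_differential_operator_lie:
  "relative_differential_operator d \<Longrightarrow> d (lie x y) = \<rho> x (d y) - \<rho> y (d x)"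
  by (simp add: relative_differential_operator_def)

lemma relative_differential_operator_scale:
  assumes d: "relative_differential_operator d"
  shows "relative_differential_operator (\<lambda>x. scalev c (d x))"
  using d unfolding relative_differential_operator_def
  by (auto simp: Vector_Spaces.linear_iff rep_scale V.scale_right_diff_distrib
      V.scale_right_distrib V.scale_left_commute)

lemma O_operator_inv:
  assumes d: "relative_differential_operator d" and "bij d"
  shows "O_operator (inv d)"
proof -
  have inj: "inj d" and d_inv: "\<And>y. d (inv d y) = y"
    using \<open>bij d\<close> by (auto simp: bij_def surj_f_inv_f)
  have "lie (inv d u) (inv d v) = inv d (\<rho> (inv d u) v - \<rho> (inv d v) u)" for u v
    by (rule injD[OF inj]) (simp add: d_inv relative_differential_operator_lie[OF d])
  then show ?thesis
    using linear_inv_of_bij[OF relative_differential_operator_linear[OF d] \<open>bij d\<close>]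
    by (simp add: O_operator_def)
qed

text \<open>
  Apply the injective \<open>e\<close> to the Nijenhuis identity. The derivation rule of \<open>e \<circ> N\<close> on
  \<open>[N x, y] + [x, N y]\<close> gives \<open>e [N x, N y]\<close> together with \<open>\<rho> x (e (N (N y))) - \<rho> y (e (N (N x)))\<close>;
  as \<open>N\<^sup>2 = c Id\<close>, the latter is \<open>c e [x, y]\<close> by the derivation rule of \<open>e\<close>, and
  \<open>e (N (N [x, y]))\<close> removes it.
\<close>

lemma nijenhuis_operator_of_scalar_square:
  assumes e: "relative_differential_operator e" and "inj e"
    and eN: "relative_differential_operator (e \<circ> N)"
    and N: "Vector_Spaces.linear scaleg scaleg N"
    and N2: "\<And>x. N (N x) = scaleg c x"
  shows "nijenhuis_operator N"
proof -
  have e_scale: "e (scaleg c x) = scalev c (e x)" for x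
    using relative_differential_operator_linear[OF e] by (simp add: Vector_Spaces.linear_iff)
  have e_add: "e (x + y) = e x + e y" and e_diff: "e (x - y) = e x - e y" for x y
    using relative_differential_operator_linear[OF e]
    by (auto simp: module_hom.add module_hom.diff Vector_Spaces.linear_def)
  have N_add: "N (x + y) = N x + N y" and N_diff: "N (x - y) = N x - N y" for x y
    using N by (auto simp: module_hom.add module_hom.diff Vector_Spaces.linear_def)
  have "lie (N x) (N y) = N (lie (N x) y + lie x (N y) - N (lie x y))" for x y
  proof (rule injD[OF \<open>inj e\<close>])
    have "e (N (lie (N x) y + lie x (N y) - N (lie x y)))
        = e (N (lie (N x) y)) + e (N (lie x (N y))) - scalev c (e (lie x y))"
      by (simp add: N_add N_diff e_add e_diff N2 e_scale)
    also have "\<dots> = \<rho> (N x) (e (N y)) - \<rho> (N y) (e (N x))"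
      using relative_differential_operator_lie[OF eN]
      by (simp add: relative_differential_operator_lie[OF e] N2 e_scale rep_scale
          V.scale_right_diff_distrib)
    also have "\<dots> = e (lie (N x) (N y))"
      by (simp add: relative_differential_operator_lie[OF e])
    finally show "e (lie (N x) (N y)) = e (N (lie (N x) y + lie x (N y) - N (lie x y)))" ..
  qed
  then show ?thesis using N by (simp add: nijenhuis_operator_def)
qed

text \<open>
  With \<open>v = e y\<close> and \<open>G x y = c \<rho> x (e y) - S (\<rho> x (e (N y)))\<close>, the dual condition reads
  \<open>\<rho> (N x) (e (N y)) - S (\<rho> (N x) (e y)) = G x y\<close>. Expanding \<open>e (N [N x, y]) = S (e [N x, y])\<close>
  by the derivation rules of \<open>e \<circ> N\<close> and \<open>e\<close> yields this equation with \<open>G y x\<close> in place of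
  \<open>G x y\<close>. Finally \<open>G\<close> is symmetric, since \<open>G x y - G y x = c e [x, y] - S (e (N [x, y]))\<close> and \<open>S \<circ> e \<circ> N = e \<circ> N\<^sup>2 = c e\<close>.
\<close>

lemma dual_nijenhuis_pair_of_scalar_square:
  assumes e: "relative_differential_operator e" and "bij e"
    and eN: "relative_differential_operator (e \<circ> N)"
    and N: "Vector_Spaces.linear scaleg scaleg N"
    and S: "Vector_Spaces.linear scalev scalev S"
    and N2: "\<And>x. N (N x) = scaleg c x"
    and Se: "\<And>x. S (e x) = e (N x)"
  shows "dual_nijenhuis_pair N S"
proof -
  have e_scale: "e (scaleg c x) = scalev c (e x)" for x
    using relative_differential_operator_linear[OF e] by (simp add: Vector_Spaces.linear_iff)
  have S_diff: "S (u - v) = S u - S v" for u v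
    using S by (auto simp: module_hom.diff Vector_Spaces.linear_def)
  note e_lie = relative_differential_operator_lie[OF e]
  note eN_lie = relative_differential_operator_lie[OF eN, unfolded o_apply]
  define G where "G x y = scalev c (\<rho> x (e y)) - S (\<rho> x (e (N y)))" for x y
  have G_sym: "G x y = G y x" for x y
  proof -
    have "scalev c (e (lie x y)) = S (e (N (lie x y)))"
      by (simp add: Se N2 e_scale)
    then have "scalev c (\<rho> x (e y)) - scalev c (\<rho> y (e x))
        = S (\<rho> x (e (N y))) - S (\<rho> y (e (N x)))"
      by (simp add: e_lie eN_lie S_diff V.scale_right_diff_distrib)
    then show ?thesis by (simp add: G_def algebra_simps)
  qed
  have G_swapped: "\<rho> (N x) (e (N y)) - S (\<rho> (N x) (e y)) = G y x" for x y
  proof -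
    have "e (N (lie (N x) y)) = S (e (lie (N x) y))"
      by (simp add: Se)
    then have "\<rho> (N x) (e (N y)) - scalev c (\<rho> y (e x))
        = S (\<rho> (N x) (e y)) - S (\<rho> y (e (N x)))"
      by (simp add: eN_lie N2 e_scale rep_scale, simp add: e_lie S_diff)
    then show ?thesis by (simp add: G_def algebra_simps)
  qed
  have "\<rho> (N x) (S v) = S (\<rho> (N x) v) + \<rho> x (S (S v)) - S (\<rho> x (S v))" for x v
  proof -
    obtain y where "v = e y"
      using \<open>bij e\<close> by (metis bij_pointE)
    moreover have "\<rho> (N x) (e (N y)) - S (\<rho> (N x) (e y)) = G x y"
      by (simp only: G_swapped G_sym[of x y])
    ultimately show ?thesis
      by (simp add: Se N2 e_scale rep_scale G_def algebra_simps)
  qed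
  moreover have "nijenhuis_operator N"
    using nijenhuis_operator_of_scalar_square[OF e _ eN N N2] \<open>bij e\<close> by (simp add: bij_def)
  ultimately show ?thesis using S by (simp add: dual_nijenhuis_pair_def)
qed

text \<open>
  Defining \<open>S\<close> as the conjugate of \<open>N\<close> by \<open>e\<close> is forced by \<open>N \<circ> e\<^sup>-\<^sup>1 = e\<^sup>-\<^sup>1 \<circ> S\<close>. Stating the
  result for one operator \<open>e\<close> with \<open>N\<^sup>2\<close> an arbitrary scalar makes it apply equally to the two
  operators that \<open>N\<close> exchanges up to a factor.
\<close>

lemma KN_structure_of_conjugate:
  assumes e: "relative_differential_operator e" and "bij e"
    and eN: "relative_differential_operator (e \<circ> N)"
    and N2: "\<And>x. N (N x) = scaleg c x"
    and S: "S = e \<circ> N \<circ> inv e"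
  shows "KN_structure (inv e) S N"
proof -
  have inv_e: "inv e (e x) = x" and e_inv: "e (inv e v) = v" for x v
    using \<open>bij e\<close> by (auto simp: bij_def surj_f_inv_f)
  have Se: "S (e x) = e (N x)" for x
    by (simp add: S inv_e)
  have lin_inv: "Vector_Spaces.linear scalev scaleg (inv e)"
    using relative_differential_operator_linear[OF e] \<open>bij e\<close> by (rule linear_inv_of_bij)
  have lin_S: "Vector_Spaces.linear scalev scalev S"
    unfolding S
    by (rule Vector_Spaces.linear_compose[OF lin_inv relative_differential_operator_linear[OF eN]])
  have "N = inv e \<circ> (e \<circ> N)"
    by (simp add: fun_eq_iff inv_e)
  then have lin_N: "Vector_Spaces.linear scaleg scaleg N"
    using Vector_Spaces.linear_compose[OF relative_differential_operator_linear[OF eN] lin_inv]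
    by simp
  have S_diff: "S (u - v) = S u - S v" for u v
    using lin_S by (auto simp: module_hom.diff Vector_Spaces.linear_def)
  have NT: "N (inv e v) = inv e (S v)" for v
    by (simp add: S inv_e)
  have "op_bracket (N \<circ> inv e) u v = deformed_op_bracket (inv e) S u v" for u v
  proof -
    let ?x = "inv e u" and ?y = "inv e v"
    \<comment> \<open>Expanding \<open>e [x, y]\<close> on the left and \<open>S \<circ> e = e \<circ> N\<close> on the right shows that \<open>S\<close> can be
      moved inside the bracket of \<open>e\<^sup>-\<^sup>1\<close>; \<open>N \<circ> e\<^sup>-\<^sup>1 = e\<^sup>-\<^sup>1 \<circ> S\<close> matches the other terms.\<close>
    have "S (e (lie ?x ?y)) = \<rho> ?x (S v) - \<rho> ?y (S u)"
      using relative_differential_operator_lie[OF eN, of ?x ?y]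
      by (simp add: Se, simp add: NT e_inv)
    then have "S (\<rho> ?x v) - S (\<rho> ?y u) = \<rho> ?x (S v) - \<rho> ?y (S u)"
      by (simp add: relative_differential_operator_lie[OF e] e_inv S_diff)
    then show ?thesis
      by (simp add: op_bracket_def deformed_op_bracket_def NT S_diff algebra_simps)
  qed
  moreover have "dual_nijenhuis_pair N S"
    using e \<open>bij e\<close> eN lin_N lin_S N2 Se by (rule dual_nijenhuis_pair_of_scalar_square)
  ultimately show ?thesis
    using O_operator_inv[OF e \<open>bij e\<close>] NT by (simp add: KN_structure_def fun_eq_iff)
qed

end

lemma mod3_neighbours:
  fixes i k :: 3
  assumes "i \<noteq> k"
  shows "i = k - 1 \<or> i = k + 1"
proof -
  have "x = 0 \<or> x = 1 \<or> x = 2" for x :: 3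
  proof (cases x)
    case (of_int z)
    then have "z \<in> {0, 1, 2}" by auto
    then show ?thesis using of_int by auto
  qed
  from this[of i] this[of k] show ?thesis using assms by auto
qed

theorem theorem3p12:
  fixes scaleg :: "'k::field \<Rightarrow> 'g::ab_group_add \<Rightarrow> 'g"
    and lie :: "'g \<Rightarrow> 'g \<Rightarrow> 'g"
    and scalev :: "'k \<Rightarrow> 'v::ab_group_add \<Rightarrow> 'v"
    and \<rho> :: "'g \<Rightarrow> 'v \<Rightarrow> 'v"
    and \<epsilon> :: "3 \<Rightarrow> 'k"
    and d :: "3 \<Rightarrow> 'g \<Rightarrow> 'v"
    and i k :: 3
  assumes "lie_algebra_representation scaleg lie scalev \<rho>"
    and "lie_algebra_representation.hyper_relative_differential_operator scaleg lie scalev \<rho> \<epsilon> d"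
    and "i \<noteq> k"
  shows "lie_algebra_representation.KN_structure scaleg lie scalev \<rho>
           (hyper_T d i) (hyper_S d k) (hyper_N d k)"
proof -
  interpret lie_algebra_representation scaleg lie scalev \<rho> by fact
  define a where "a = d (k - 1)"
  define b where "b = d (k + 1)"
  define N where "N = hyper_N d k"
  have a: "relative_differential_operator a" "bij a" and b: "relative_differential_operator b" "bij b"
    and N2: "N (N x) = scaleg (\<epsilon> k) x" for x
    using assms(2) by (auto simp: hyper_relative_differential_operator_def a_def b_def N_def)
  have inv_a: "inv a (a x) = x" and a_inv: "a (inv a v) = v" and b_inv: "b (inv b v) = v" for x v
    using a(2) b(2) by (auto simp: bij_def surj_f_inv_f)
  have N: "N = inv a \<circ> b" and S: "hyper_S d k = b \<circ> inv a"
    by (simp_all add: N_def hyper_N_def hyper_S_def hyper_T_def a_def b_def)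
  have aN: "a \<circ> N = b"
    by (simp add: N fun_eq_iff a_inv)
  have bN: "b \<circ> N = (\<lambda>x. scalev (\<epsilon> k) (a x))"
  proof
    fix x
    have "(b \<circ> N) x = a (N (N x))"
      using aN by (simp add: fun_eq_iff)
    also have "\<dots> = scalev (\<epsilon> k) (a x)"
      using relative_differential_operator_linear[OF a(1)] by (simp add: N2 Vector_Spaces.linear_iff)
    finally show "(b \<circ> N) x = scalev (\<epsilon> k) (a x)" .
  qed
  have "KN_structure (inv a) (hyper_S d k) N"
    using a _ N2 by (rule KN_structure_of_conjugate) (simp_all add: aN b S)
  moreover have "KN_structure (inv b) (hyper_S d k) N"
    using b _ N2
    by (rule KN_structure_of_conjugate)
      (simp add: bN relative_differential_operator_scale a, simp add: S N fun_eq_iff b_inv)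
  ultimately show ?thesis
    using mod3_neighbours[OF assms(3)] by (auto simp: hyper_T_def a_def b_def N_def)
qed

end
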